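(* Let $\mathfrak{A}$ be a complex unital $C^*$-algebra, let $x_1,x_2\in\mathfrak{A}$ be two regular elements with Moore-Penrose inverses $x_1^{\dagger},x_2^{\dagger}$, and let $\mu\ge 0$ be real. Then \begin{align*} v^2(x_1+x_2)\le{}&\frac{1}{2(1+\mu)}\Big(v(x_1)\big\|x_1x_1^{\dagger}+x_1^*x_1\big\|+v(x_2)\big\|x_2x_2^{\dagger}+x_2^*x_2\big\|\Big)\\ &+\frac{\mu}{2(1+\mu)}\big\|x_1x_1^{\dagger}+x_2x_2^{\dagger}+(x_1^*x_1)^2+(x_2^*x_2)^2\big\|+2v(x_1)v(x_2). \end{align*}
   Context: $\mathcal{S}(\mathfrak{A})$ denotes the set of states of $\mathfrak{A}$ (positive linear functionals $\varphi$ with $\varphi(\mathbf{1}_{\mathfrak{A}})=1$), and $v(x)=\sup\{|\varphi(x)|:\varphi\in\mathcal{S}(\mathfrak{A})\}$ is the algebraic numerical radius; $v^2(x)$ means $(v(x))^2$. An element $x\in\mathfrak{A}$ is regular if there is $x'\in\mathfrak{A}$ with $x=xx'x$. Every regular $x\in\mathfrak{A}$ has a unique Moore-Penrose inverse, i.e. a unique $x^{\dagger}\in\mathfrak{A}$ with $x^{\dagger}=x^{\dagger}xx^{\dagger}$, $x=xx^{\dagger}x$, $(x^{\dagger}x)^*=x^{\dagger}x$, $(xx^{\dagger})^*=xx^{\dagger}$. *)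

theory Defs
  imports "HOL-Analysis.Analysis"
begin

(* Complex unital C*-algebras. HOL-Analysis only has real algebras, so the complex scalar
   multiplication is a new operation that is required to extend scaleR. The superclasses
   provide a nonzero unit with norm 1, the triangle inequality, submultiplicativity of
   the norm and completeness. *)
class cstar_algebra = real_normed_algebra_1 + banach +
  fixes scaleC :: "complex \<Rightarrow> 'a \<Rightarrow> 'a" (infixr "*\<^sub>C" 75)
    and star :: "'a \<Rightarrow> 'a"
  assumes scaleC_add_right: "a *\<^sub>C (x + y) = a *\<^sub>C x + a *\<^sub>C y"
    and scaleC_add_left: "(a + b) *\<^sub>C x = a *\<^sub>C x + b *\<^sub>C x"
    and scaleC_scaleC: "a *\<^sub>C b *\<^sub>C x = (a * b) *\<^sub>C x"
    and scaleC_of_real: "complex_of_real r *\<^sub>C x = r *\<^sub>R x"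
    and mult_scaleC_left: "(a *\<^sub>C x) * y = a *\<^sub>C (x * y)"
    and mult_scaleC_right: "x * (a *\<^sub>C y) = a *\<^sub>C (x * y)"
    and norm_scaleC: "norm (a *\<^sub>C x) = cmod a * norm x"
    and star_star: "star (star x) = x"
    and star_add: "star (x + y) = star x + star y"
    and star_scaleC: "star (a *\<^sub>C x) = cnj a *\<^sub>C star x"
    and star_mult: "star (x * y) = star y * star x"
    and cstar_identity: "norm (star x * x) = (norm x)\<^sup>2"

definition clinear_functional :: "('a::cstar_algebra \<Rightarrow> complex) \<Rightarrow> bool" where
  "clinear_functional \<phi> \<longleftrightarrow>
     (\<forall>x y. \<phi> (x + y) = \<phi> x + \<phi> y) \<and> (\<forall>c x. \<phi> (c *\<^sub>C x) = c * \<phi> x)"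

definition positive_functional :: "('a::cstar_algebra \<Rightarrow> complex) \<Rightarrow> bool" where
  "positive_functional \<phi> \<longleftrightarrow> (\<forall>x. \<phi> (star x * x) \<in> \<real>\<^sub>\<ge>\<^sub>0)"

definition states :: "('a::cstar_algebra \<Rightarrow> complex) set" where
  "states = {\<phi>. clinear_functional \<phi> \<and> positive_functional \<phi> \<and> \<phi> 1 = 1}"

(* The supremum is a genuine one: a unital C*-algebra with nonzero unit has a state, and
   every state satisfies |\<phi> x| \<le> norm x. *)
definition numerical_radius :: "'a::cstar_algebra \<Rightarrow> real" where
  "numerical_radius x = (SUP \<phi>\<in>states. cmod (\<phi> x))"

definition regular_element :: "'a::cstar_algebra \<Rightarrow> bool" where
  "regular_element x \<longleftrightarrow> (\<exists>x'. x = x * x' * x)"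

definition is_moore_penrose_inverse :: "'a::cstar_algebra \<Rightarrow> 'a \<Rightarrow> bool" where
  "is_moore_penrose_inverse x y \<longleftrightarrow>
     y = y * x * y \<and> x = x * y * x \<and> star (y * x) = y * x \<and> star (x * y) = x * y"

end

(* For a state \<phi> and the projection p = x x^dag one has x = p x, so Cauchy-Schwarz gives
   |\<phi> x|^2 \<le> \<phi> p * \<phi> (x^* x). Bounding the geometric mean of the two factors by their arithmetic
   mean gives 2 |\<phi> x|^2 \<le> v x * norm (p + x^* x), and applying this mean inequality to their
   squares gives 2 |\<phi> x|^2 \<le> \<phi> (p + (x^* x)^2). Since |\<phi> (x1 + x2)|^2 is at most
   |\<phi> x1|^2 + |\<phi> x2|^2 + 2 |\<phi> x1| |\<phi> x2|, the claim is a weighted mean of the two bounds.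

   The numerical radius is a supremum of reals, which is meaningless for an empty set, so the
   existence of a state is needed. It comes from the Hahn-Banach theorem once x^* x is known to be
   positive, where h is called positive if norm (t - h) \<le> t for some t \<ge> 0. This criterion makes
   positivity additive and avoids spectral theory altogether. *)

theory Submission
  imports Defs
begin

section \<open>Elementary identities\<close>

lemma star_scaleR: "star (r *\<^sub>R x) = r *\<^sub>R star (x::'a::cstar_algebra)"
  by (metis star_scaleC scaleC_of_real complex_cnj_complex_of_real)

lemma star_minus: "star (- x) = - star (x::'a::cstar_algebra)"
  using star_scaleR[of "-1" x] by simp

lemma star_diff: "star (x - y) = star x - star (y::'a::cstar_algebra)"
  by (metis diff_conv_add_uminus star_add star_minus)

lemma star_one: "star 1 = (1::'a::cstar_algebra)"
  by (metis mult.right_neutral star_mult star_star)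

lemma star_of_real: "star (of_real r) = (of_real r :: 'a::cstar_algebra)"
  by (simp add: of_real_def star_scaleR star_one)

lemma star_power: "star (x ^ n) = star (x::'a::cstar_algebra) ^ n"
  by (induction n) (simp_all add: star_one star_mult power_commutes)

text \<open>The C*-identity and submultiplicativity give one inequality for every element; applying
  it to \<open>star x\<close> as well gives the other.\<close>

lemma norm_star: "norm (star x) = norm (x::'a::cstar_algebra)"
proof -
  have *: "norm z \<le> norm (star z)" for z :: 'a
  proof (cases "z = 0")
    case False
    have "norm z * norm z \<le> norm (star z) * norm z"
      by (metis cstar_identity norm_mult_ineq power2_eq_square)
    with False show ?thesis by simp
  qed simp
  show ?thesis using *[of x] *[of "star x"] by (simp add: star_star)
qed

lemma continuous_on_star: "continuous_on UNIV (star :: 'a::cstar_algebra \<Rightarrow> 'a)"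
  unfolding continuous_on_iff
  by (metis dist_norm norm_star star_diff)

lemma norm_square_selfadjoint:
  fixes h :: "'a::cstar_algebra"
  assumes "star h = h"
  shows "norm (h * h) = norm h * norm h"
  using cstar_identity[of h] assms by (simp add: power2_eq_square)

text \<open>The square of the selfadjoint \<open>h ^ (m + 1)\<close> is
  \<open>h ^ m * h ^ (m + 2)\<close>, so the norms of the two preceding powers force the lower bound
  for \<open>h ^ (m + 2)\<close>.\<close>

lemma norm_power_selfadjoint:
  fixes h :: "'a::cstar_algebra"
  assumes h: "star h = h"
  shows "norm (h ^ n) = norm h ^ n"
proof (cases "h = 0")
  case False
  show ?thesis
  proof (induction n rule: nat_less_induct)
    case (1 n)
    consider "n = 0" | "n = 1" | m where "n = Suc (Suc m)"
      by (metis One_nat_def not0_implies_Suc)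
    then show ?case
    proof cases
      case 3
      have IH: "norm (h ^ Suc m) = norm h ^ Suc m" "norm (h ^ m) = norm h ^ m"
        using 1 3 by auto
      have "(norm h ^ Suc m)\<^sup>2 = norm (h ^ m * h ^ n)"
        using norm_square_selfadjoint[of "h ^ Suc m"] IH(1) h 3
        by (simp add: star_power power2_eq_square flip: power_add power_Suc)
      also have "\<dots> \<le> norm h ^ m * norm (h ^ n)"
        using norm_mult_ineq[of "h ^ m" "h ^ n"] IH(2) by simp
      finally have "norm h ^ m * norm h ^ n \<le> norm h ^ m * norm (h ^ n)"
        using 3 by (simp add: power2_eq_square algebra_simps)
      then have "norm h ^ n \<le> norm (h ^ n)" using False by simp
      then show ?thesis by (simp add: norm_power_ineq order_antisym)
    qed auto
  qed
qed (cases n, auto)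

section \<open>Square roots of selfadjoint elements\<close>

(* The root is 1 - w for the fixed point w of the contraction w |-> (h + w^2) / 2. *)
lemma selfadjoint_sqrt:
  fixes h :: "'a::cstar_algebra"
  assumes h: "star h = h" and lt: "norm h < 1"
  shows "\<exists>y. star y = y \<and> y * y = 1 - h \<and> (\<forall>z. z * h = h * z \<longrightarrow> z * y = y * z)"
proof -
  \<comment> \<open>Selfadjointness and commutation with everything that commutes with
    \<open>h\<close> are closed conditions preserved by \<open>f\<close>; built into
    \<open>S\<close>, they pass to the fixed point.\<close>
  define S where "S = cball 0 (norm h) \<inter> {w. star w = w} \<inter> (\<Inter>z\<in>{z. z * h = h * z}. {w. z * w = w * z})"
  define f where "f w = (1/2) *\<^sub>R (h + w * w)" for w
  have "closed {w :: 'a. star w = w}"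
    by (intro closed_Collect_eq continuous_on_star continuous_on_id)
  moreover have "closed {w :: 'a. z * w = w * z}" for z
    by (intro closed_Collect_eq continuous_intros)
  ultimately have "closed S"
    unfolding S_def by (intro closed_Int closed_INT closed_cball ballI)
  have S: "norm w \<le> norm h" "star w = w" if "w \<in> S" for w
    using that by (auto simp: S_def)
  have fS: "f w \<in> S" if w: "w \<in> S" for w
  proof -
    have "norm (w * w) \<le> norm h * 1"
      using S(1)[OF w] lt by (intro order_trans[OF norm_mult_ineq] mult_mono) auto
    then have "norm (h + w * w) \<le> 2 * norm h"
      using norm_triangle_ineq[of h "w * w"] by simp
    moreover have "z * (w * w) = (w * w) * z" if "z * h = h * z" for z
    proof -
      have "z * w = w * z" using w that by (auto simp: S_def)
      then show ?thesis by (metis mult.assoc)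
    qed
    ultimately show ?thesis
      using S(2)[OF w]
      by (auto simp: S_def f_def star_scaleR star_add star_mult h distrib_left distrib_right)
  qed
  \<comment> \<open>The factor 1/2 in \<open>f\<close> offsets the two summands of
    \<open>v * (v - w) + (v - w) * w\<close>, leaving the Lipschitz constant
    \<open>norm h < 1\<close>.\<close>
  have contr: "dist (f v) (f w) \<le> norm h * dist v w" if "v \<in> S" "w \<in> S" for v w
  proof -
    have "v * v - w * w = v * (v - w) + (v - w) * w" by (simp add: algebra_simps)
    then have "norm (v * v - w * w) \<le> norm v * norm (v - w) + norm (v - w) * norm w"
      by (metis norm_triangle_le add_mono norm_mult_ineq)
    also have "\<dots> \<le> norm h * norm (v - w) + norm (v - w) * norm h"
      using S(1) that by (intro add_mono mult_mono) auto
    finally have "norm (v * v - w * w) \<le> 2 * (norm h * norm (v - w))" by simp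
    moreover have "f v - f w = (1/2) *\<^sub>R (v * v - w * w)"
      by (simp add: f_def scaleR_diff_right scaleR_add_right)
    ultimately show ?thesis by (simp add: dist_norm)
  qed
  have "0 \<in> S" using star_scaleR[of 0 0] by (simp add: S_def)
  then have "\<exists>!w\<in>S. f w = w"
    using \<open>closed S\<close> fS contr lt
    by (intro Banach_fix[where c = "norm h"]) (auto simp: complete_eq_closed)
  then obtain w where w: "w \<in> S" "f w = w" by blast
  have "h + w * w = 2 *\<^sub>R w"
    using arg_cong[OF w(2), of "\<lambda>u. 2 *\<^sub>R u"] by (simp add: f_def)
  then have "w * w = w + w - h" by (simp add: scaleR_2 algebra_simps)
  then have "(1 - w) * (1 - w) = 1 - h" by (simp add: algebra_simps)
  moreover have "star (1 - w) = 1 - w" using S(2) w(1) by (simp add: star_diff star_one)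
  moreover have "z * (1 - w) = (1 - w) * z" if "z * h = h * z" for z
  proof -
    have "z * w = w * z" using w(1) that by (auto simp: S_def)
    then show ?thesis by (simp add: algebra_simps)
  qed
  ultimately show ?thesis by blast
qed

section \<open>Decomposition into real and imaginary parts\<close>

definition real_part :: "'a::cstar_algebra \<Rightarrow> 'a" where
  "real_part x = (1/2) *\<^sub>R (x + star x)"

text \<open>Written as a real part, so that selfadjointness and real linearity carry over from
  \<open>real_part\<close>.\<close>

definition imag_part :: "'a::cstar_algebra \<Rightarrow> 'a" where
  "imag_part x = real_part ((- \<i>) *\<^sub>C x)"

lemma scaleC_scaleR: "c *\<^sub>C r *\<^sub>R x = r *\<^sub>R c *\<^sub>C (x::'a::cstar_algebra)"
  by (metis scaleC_scaleC scaleC_of_real mult.commute)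

lemma scaleC_one: "1 *\<^sub>C x = (x::'a::cstar_algebra)"
  by (metis scaleC_of_real of_real_1 scaleR_one)

lemma scaleC_minus_left: "(- c) *\<^sub>C x = - (c *\<^sub>C (x::'a::cstar_algebra))"
  by (metis add.inverse_unique add.right_inverse scaleC_add_left scaleC_of_real of_real_0 scaleR_zero_left)

lemma scaleC_minus_right: "c *\<^sub>C (- x) = - (c *\<^sub>C (x::'a::cstar_algebra))"
  using scaleC_scaleR[of c "-1" x] by simp

lemma scaleC_diff_right: "c *\<^sub>C (x - y) = c *\<^sub>C x - c *\<^sub>C (y::'a::cstar_algebra)"
  by (metis diff_conv_add_uminus scaleC_add_right scaleC_minus_right)

lemma star_real_part: "star (real_part x) = real_part (x::'a::cstar_algebra)"
  by (simp add: real_part_def star_scaleR star_add star_star add.commute)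

lemma star_imag_part: "star (imag_part x) = imag_part (x::'a::cstar_algebra)"
  by (simp add: imag_part_def star_real_part)

lemma imag_part_eq: "imag_part x = (1/2) *\<^sub>R (\<i> *\<^sub>C (star x - (x::'a::cstar_algebra)))"
  by (simp add: imag_part_def real_part_def star_scaleC scaleC_minus_left scaleC_diff_right star_minus)

lemma real_imag_parts: "x = real_part x + \<i> *\<^sub>C imag_part (x::'a::cstar_algebra)"
proof -
  have "\<i> *\<^sub>C imag_part x = (1/2) *\<^sub>R (x - star x)"
    unfolding imag_part_eq scaleC_scaleR[of \<i>] by (simp add: scaleC_scaleC scaleC_minus_left scaleC_one)
  then show ?thesis
    by (simp add: real_part_def flip: scaleR_add_right scaleR_2)
qed

text \<open>With \<open>y\<close> written as a + i b, the mixed terms cancel between the two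
  products. This yields a sum of selfadjoint squares before \<open>star y * y\<close> itself is
  known to be positive.\<close>

lemma star_square_add_square_star:
  fixes y :: "'a::cstar_algebra"
  shows "star y * y + y * star y =
    2 *\<^sub>R (real_part y * real_part y) + 2 *\<^sub>R (imag_part y * imag_part y)"
proof -
  define a b where "a = real_part y" and "b = imag_part y"
  have y: "y = a + \<i> *\<^sub>C b" using real_imag_parts[of y] by (simp add: a_def b_def)
  have "star y = a - \<i> *\<^sub>C b"
    using arg_cong[OF y, of star] 
    by (simp add: star_add star_scaleC a_def b_def star_real_part star_imag_part scaleC_minus_left)
  then have "star y * y + y * star y = (a - \<i> *\<^sub>C b) * (a + \<i> *\<^sub>C b) + (a + \<i> *\<^sub>C b) * (a - \<i> *\<^sub>C b)"
    using y by simp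
  also have "\<dots> = 2 *\<^sub>R (a * a) + 2 *\<^sub>R (b * b)"
    by (simp add: algebra_simps mult_scaleC_left mult_scaleC_right scaleC_scaleC scaleC_minus_left
        scaleC_add_right scaleC_diff_right scaleC_one scaleR_2)
  finally show ?thesis by (simp add: a_def b_def)
qed

(* With y^2 = 1 - a^2, the element a + i y is unitary and y is its imaginary part. *)
lemma norm_one_minus_square_le:
  fixes a :: "'a::cstar_algebra"
  assumes a: "star a = a" and lt: "norm a < 1"
  shows "norm (1 - a * a) \<le> 1"
proof -
  have "norm (a * a) < 1"
    using norm_square_selfadjoint[OF a] lt
    by (simp add: abs_square_less_1 flip: power2_eq_square)
  \<comment> \<open>Commutation of \<open>y\<close> with \<open>a\<close> is what cancels the mixed
    terms of \<open>star u * u\<close>.\<close>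
  then obtain y where y: "star y = y" "y * y = 1 - a * a" "a * y = y * a"
    using selfadjoint_sqrt[of "a * a"] a by (auto simp: star_mult mult.assoc)
  define u where "u = a + \<i> *\<^sub>C y"
  have su: "star u = a - \<i> *\<^sub>C y"
    by (simp add: u_def star_add star_scaleC a y scaleC_minus_left)
  have "star u * u = a * a + y * y"
    unfolding su
    by (simp add: u_def algebra_simps mult_scaleC_left mult_scaleC_right scaleC_scaleC
        scaleC_minus_left scaleC_add_right scaleC_diff_right scaleC_one y(3))
  then have "norm u = 1" using cstar_identity[of u] y(2) by (simp add: abs_square_eq_1)
  moreover have "u - star u = 2 *\<^sub>R \<i> *\<^sub>C y" unfolding su by (simp add: u_def scaleR_2)
  then have "2 * norm y = norm (u - star u)" by (simp add: norm_scaleC)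
  ultimately have "norm y \<le> 1"
    using norm_triangle_ineq4[of u "star u"] by (simp add: norm_star)
  then show ?thesis
    using norm_square_selfadjoint[OF y(1)] y(2) by (simp add: mult_le_one)
qed

section \<open>Positive elements\<close>

text \<open>For selfadjoint \<open>h\<close> the norm condition says that the spectrum lies in the
  interval from 0 to \<open>2 * t\<close>.\<close>

definition positive_element :: "'a::cstar_algebra \<Rightarrow> bool" where
  "positive_element h \<longleftrightarrow> star h = h \<and> (\<exists>t\<ge>0. norm (of_real t - h) \<le> t)"

lemma positive_element_add:
  assumes "positive_element h" "positive_element k"
  shows "positive_element (h + k)"
proof -
  obtain s t where st: "s \<ge> 0" "norm (of_real s - h) \<le> s" "t \<ge> 0" "norm (of_real t - k) \<le> t"
    using assms by (auto simp: positive_element_def)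
  have "norm (of_real (s + t) - (h + k)) \<le> s + t"
    using norm_triangle_ineq[of "of_real s - h" "of_real t - k"] st by (simp add: algebra_simps)
  then show ?thesis
    using assms st by (auto simp: positive_element_def star_add intro!: exI[of _ "s + t"])
qed

lemma positive_element_scaleR:
  assumes "positive_element h" "c \<ge> 0"
  shows "positive_element (c *\<^sub>R h)"
proof -
  obtain s where s: "s \<ge> 0" "norm (of_real s - h) \<le> s"
    using assms by (auto simp: positive_element_def)
  have "of_real (c * s) - c *\<^sub>R h = c *\<^sub>R (of_real s - h)"
    by (simp add: algebra_simps scaleR_conv_of_real)
  then have "norm (of_real (c * s) - c *\<^sub>R h) \<le> c * s"
    using s assms(2) by (simp add: mult_left_mono)
  then show ?thesis
    using assms s by (auto simp: positive_element_def star_scaleR intro!: exI[of _ "c * s"])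
qed

text \<open>Division of \<open>a\<close> by \<open>sqrt t\<close> reduces this to
  \<open>norm_one_minus_square_le\<close>, whose strict norm condition is the reason for
  \<open><\<close> here.\<close>

lemma norm_diff_square_le:
  fixes a :: "'a::cstar_algebra"
  assumes a: "star a = a" and lt: "norm a ^ 2 < t"
  shows "norm (of_real t - a * a) \<le> t"
proof -
  have t: "t > 0" using lt zero_le_power2[of "norm a"] by linarith
  define b where "b = (1 / sqrt t) *\<^sub>R a"
  have "norm a < sqrt t" using lt real_less_rsqrt by blast
  then have "norm (1 - b * b) \<le> 1"
    using t a by (intro norm_one_minus_square_le) (auto simp: b_def star_scaleR)
  moreover have "of_real t - a * a = t *\<^sub>R (1 - b * b)"
    using t by (simp add: b_def scaleR_diff_right) (simp add: scaleR_conv_of_real)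
  ultimately show ?thesis using t by (simp add: mult_left_le)
qed

lemma positive_element_square:
  assumes "star a = a"
  shows "positive_element (a * a)"
proof -
  have "norm (of_real ((norm a)\<^sup>2 + 1) - a * a) \<le> (norm a)\<^sup>2 + 1"
    by (intro norm_diff_square_le assms) simp
  then show ?thesis
    using assms unfolding positive_element_def
    by (auto simp: star_mult simp del: of_real_add intro!: exI[of _ "(norm a)\<^sup>2 + 1"])
qed

text \<open>The definition provides only some \<open>t\<close>; here every \<open>t\<close> from
  \<open>norm h\<close> on is shown to work. For \<open>e > 0\<close> the element
  \<open>h + e\<close> is the square of a selfadjoint \<open>z\<close>, to which
  \<open>norm_diff_square_le\<close> applies; then \<open>e\<close> tends to 0.\<close>

lemma positive_element_norm_le:
  assumes pos: "positive_element h" and t: "norm h \<le> t"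
  shows "norm (of_real t - h) \<le> t"
proof (rule field_le_epsilon)
  fix d :: real assume "d > 0"
  define e where "e = d / 3"
  have e: "e > 0" using \<open>d > 0\<close> by (simp add: e_def)
  obtain s where s: "s \<ge> 0" "norm (of_real s - h) \<le> s" and h: "star h = h"
    using pos by (auto simp: positive_element_def)
  \<comment> \<open>Dividing by \<open>s + e\<close> instead of \<open>s\<close> makes the norm
    strictly less than 1, and \<open>1 - u\<close> is \<open>h + e\<close> divided by
    \<open>s + e\<close>.\<close>
  define u where "u = (1 / (s + e)) *\<^sub>R (of_real s - h)"
  have "norm u < 1" "star u = u"
    using s e h by (auto simp: u_def star_scaleR star_diff star_of_real divide_simps)
  then obtain y where y: "star y = y" "y * y = 1 - u"
    using selfadjoint_sqrt by blast
  define z where "z = sqrt (s + e) *\<^sub>R y"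
  have "z * z = (s + e) *\<^sub>R (1 - u)" using s e y(2) by (simp add: z_def)
  also have "\<dots> = h + of_real e"
    using s e by (simp add: u_def scaleR_diff_right) (simp add: scaleR_conv_of_real)
  finally have zz: "z * z = h + of_real e" .
  have z: "star z = z" using y by (simp add: z_def star_scaleR)
  have less: "(norm z)\<^sup>2 < t + 2 * e"
    using norm_square_selfadjoint[OF z] norm_triangle_ineq[of h "of_real e"] t e
    by (simp add: zz power2_eq_square)
  have "norm (of_real (t + e) - h) \<le> t + 2 * e"
  proof -
    have "of_real (t + 2 * e) = (of_real (t + e) + of_real e :: 'a)"
      by (simp flip: of_real_add)
    then have "of_real (t + 2 * e) - z * z = of_real (t + e) - h"
      by (simp only: zz) simp
    then show ?thesis using norm_diff_square_le[OF z less] by (simp only:)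
  qed
  moreover have "of_real t - h = (of_real (t + e) - h) - of_real e" by simp
  ultimately have "norm (of_real t - h) \<le> (t + 2 * e) + e"
    using norm_triangle_ineq4[of "of_real (t + e) - h" "of_real e"] e 
    by (metis abs_of_pos add_right_mono norm_of_real order_trans)
  then show "norm (of_real t - h) \<le> t + d" by (simp add: e_def)
qed

lemma positive_element_of_real: "c \<ge> 0 \<Longrightarrow> positive_element (of_real c)"
  by (auto simp: positive_element_def star_of_real intro!: exI[of _ c])

(* Put P = z^* z and Q = z z^* for the normalization z of y, and let c = 1/20. Were the norm of y
   large, then P \<le> c, hence Q \<ge> -c because P + Q is a sum of selfadjoint squares. This
   makes 1 + P and 1 - Q of norm at most 1 + c. By (1 + P)^2 - (1 - P)^2 = 4 P the norm of 1 - P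
   is close to sqrt 3, which contradicts P (1 - P) = z^* (1 - Q) z. *)
lemma norm_less_if_positive_one_minus_star_square:
  fixes y :: "'a::cstar_algebra"
  assumes pos: "positive_element (1 - star y * y)"
  shows "(norm y)\<^sup>2 < 20"
proof (rule ccontr)
  assume "\<not> (norm y)\<^sup>2 < 20"
  then have n: "(norm y)\<^sup>2 \<ge> 20" by simp
  then have n0: "norm y > 0" by (cases "y = 0") auto
  define c :: real where "c = 1 / 20"
  define z where "z = (1 / norm y) *\<^sub>R y"
  define P Q where "P = star z * z" and "Q = z * star z"
  have nz: "norm z = 1" using n0 by (simp add: z_def)
  have nP: "norm P = 1" using nz by (simp add: P_def cstar_identity)
  have nQ: "norm Q = 1" using nz cstar_identity[of "star z"] by (simp add: Q_def star_star norm_star)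
  have sP: "star P = P" by (simp add: P_def star_mult star_star)
  \<comment> \<open>Division by the squared norm of \<open>y\<close> turns
    \<open>1 - star y * y\<close> into a scalar minus \<open>P\<close>. By the assumed bound 20 that
    scalar is at most \<open>c\<close>, and the difference is added.\<close>
  have "positive_element ((1 / (norm y)\<^sup>2) *\<^sub>R (1 - star y * y) + of_real (c - 1 / (norm y)\<^sup>2))"
    using n n0
    by (intro positive_element_add positive_element_scaleR pos positive_element_of_real)
      (auto simp: c_def divide_simps)
  moreover have "(1 / (norm y)\<^sup>2) *\<^sub>R (1 - star y * y) + of_real (c - 1 / (norm y)\<^sup>2) = of_real c - P"
    by (simp add: P_def z_def star_scaleR scaleR_diff_right power2_eq_square)
      (simp add: of_real_def)
  ultimately have posP: "positive_element (of_real c - P)" by (simp only:)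
  have "positive_element (P + Q)"
    unfolding P_def Q_def star_square_add_square_star
    by (intro positive_element_add positive_element_scaleR positive_element_square
        star_real_part star_imag_part) auto
  from positive_element_add[OF posP this] have posQ: "positive_element (of_real c + Q)" by simp
  have "norm (of_real c + Q) \<le> c + 1"
    using norm_triangle_ineq[of "of_real c" Q] by (simp add: nQ c_def)
  then have "norm (of_real (c + 1) - (of_real c + Q)) \<le> c + 1"
    by (rule positive_element_norm_le[OF posQ])
  moreover have "of_real (c + 1) - (of_real c + Q) = 1 - Q" by simp
  ultimately have "norm (1 - Q) \<le> c + 1" by (simp only:)
  then have Q1: "norm (1 - Q) \<le> 21 / 20" by (simp add: c_def)
  have "norm (of_real c - P) \<le> c + 1"
    using norm_triangle_ineq4[of "of_real c" P] by (simp add: nP c_def)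
  then have "norm (of_real (c + 1) - (of_real c - P)) \<le> c + 1"
    by (rule positive_element_norm_le[OF posP])
  moreover have "of_real (c + 1) - (of_real c - P) = 1 + P" by simp
  ultimately have "norm (1 + P) \<le> c + 1" by (simp only:)
  then have P1: "norm (1 + P) \<le> 21 / 20" by (simp add: c_def)
  define M where "M = norm (1 - P)"
  have sq: "norm ((1 - P) * (1 - P)) = M * M"
    by (simp add: M_def norm_square_selfadjoint star_diff star_one sP)
  have "4 *\<^sub>R P = P + P + (P + P)"
    using scaleR_add_left[of 2 2 P] by (simp add: scaleR_2)
  also have "\<dots> = (1 + P) * (1 + P) - (1 - P) * (1 - P)" by (simp add: distrib_left distrib_right
      left_diff_distrib right_diff_distrib)
  finally have "4 * norm P = norm ((1 + P) * (1 + P) - (1 - P) * (1 - P))"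
    by (metis norm_scaleR abs_numeral)
  then have "4 = norm ((1 + P) * (1 + P) - (1 - P) * (1 - P))" using nP by simp
  also have "\<dots> \<le> norm ((1 + P) * (1 + P)) + M * M"
    using norm_triangle_ineq4 sq by metis
  also have "norm ((1 + P) * (1 + P)) \<le> (21 / 20) * (21 / 20)"
    using P1 by (intro order_trans[OF norm_mult_ineq] mult_mono) auto
  finally have "M * M \<ge> 4 - (21 / 20) * (21 / 20)" by simp
  \<comment> \<open>The left-hand constant is 2.89, and 4 - 1.1025 = 2.8975 is just above
    it.\<close>
  then have "(17 / 10)\<^sup>2 \<le> M\<^sup>2" by (simp add: power2_eq_square)
  then have M: "M \<ge> 17 / 10" by (rule power2_le_imp_le) (simp add: M_def)
  have "(1 - P) * (1 - P) = (1 - P) - star z * (1 - Q) * z"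
    by (simp add: P_def Q_def algebra_simps)
  then have "M * M \<le> M + norm (star z * (1 - Q) * z)"
    by (metis sq M_def norm_triangle_ineq4)
  also have "norm (star z * (1 - Q) * z) \<le> norm (star z) * norm (1 - Q) * norm z"
    by (intro order_trans[OF norm_mult_ineq] mult_right_mono norm_mult_ineq) auto
  also have "\<dots> \<le> 21 / 20" using Q1 nz by (simp add: norm_star)
  finally have "M * (M - 1) \<le> 21 / 20" by (simp add: algebra_simps)
  \<comment> \<open>The contradiction is 1.19 against 1.05.\<close>
  moreover have "(17 / 10) * (7 / 10) \<le> M * (M - 1)" using M by (intro mult_mono) auto
  ultimately show False by simp
qed

text \<open>The induction step adds the square of \<open>r ^ n - r ^ (n + 2)\<close>, whose
  expansion replaces the difference for \<open>n\<close> by the one for \<open>n + 1\<close>. For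
  \<open>n = 0\<close> the element is \<open>r * r\<close>.\<close>

lemma positive_one_minus_powers:
  fixes r :: "'a::cstar_algebra"
  assumes r: "star r = r"
  shows "positive_element (1 - (r ^ (2 * n) - r ^ (2 * n + 2)))"
proof (induction n)
  case 0
  show ?case using positive_element_square[OF r] by (simp add: power2_eq_square)
next
  case (Suc n)
  define a where "a = r ^ n"
  have "r * a = a * r" by (simp add: a_def power_commutes)
  \<comment> \<open>As rewrite rules these move every \<open>a\<close> to the left of the factors
    \<open>r\<close>.\<close>
  then have comm: "r * (r * a) = a * (r * r)" "r * (r * (a * z)) = a * (r * (r * z))" for z
    by (metis mult.assoc)+
  have "star (a - a * (r * r)) = a - a * (r * r)"
    by (simp add: star_diff star_mult star_power r a_def mult.assoc comm[unfolded a_def])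
  from positive_element_add[OF Suc positive_element_square[OF this]]
  have "positive_element (1 - (r ^ (2 * n) - r ^ (2 * n + 2)) + (a - a * (r * r)) * (a - a * (r * r)))" .
  moreover have pw: "r ^ (2 * n) = a * a" "r ^ (2 * n + 2) = a * (a * (r * r))"
    "r ^ (2 * Suc n) = a * (a * (r * r))" "r ^ (2 * Suc n + 2) = a * (a * (r * (r * (r * r))))"
    by (simp_all add: a_def mult_2 power_add mult.assoc comm[unfolded a_def])
  moreover have "(a - a * (r * r)) * (a - a * (r * r)) =
    a * a - a * (a * (r * r)) - a * (a * (r * r)) + a * (a * (r * (r * (r * r))))"
    by (simp add: left_diff_distrib right_diff_distrib mult.assoc comm)
  ultimately have "positive_element (1 - (a * a - a * (a * (r * r))) +
    (a * a - a * (a * (r * r)) - a * (a * (r * r)) + a * (a * (r * (r * (r * r))))))"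
    by (simp only:)
  moreover have "1 - (a * a - a * (a * (r * r))) +
    (a * a - a * (a * (r * r)) - a * (a * (r * r)) + a * (a * (r * (r * (r * r))))) =
    1 - (r ^ (2 * Suc n) - r ^ (2 * Suc n + 2))"
    unfolding pw by simp
  ultimately show ?case by (simp only:)
qed

(* If this fails and r^2 = 1 - x^* x, then r has norm above 1, and the elements x r^n
   contradict the previous bound for large n. *)
lemma norm_one_minus_star_square_le:
  fixes x :: "'a::cstar_algebra"
  assumes lt: "norm x < 1"
  shows "norm (1 - star x * x) \<le> 1"
proof (rule ccontr)
  assume gt: "\<not> norm (1 - star x * x) \<le> 1"
  have "norm (star x * x) < 1" using lt by (simp add: cstar_identity abs_square_less_1)
  then obtain r where r: "star r = r" "r * r = 1 - star x * x"
    using selfadjoint_sqrt[of "star x * x"] by (auto simp: star_mult star_star)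
  define R where "R = (norm r)\<^sup>2"
  have R: "R > 1" using norm_square_selfadjoint[OF r(1)] gt r(2) by (simp add: R_def power2_eq_square)
  \<comment> \<open>For \<open>y = x * r ^ n\<close> the squared norm is at least
    \<open>R ^ (n + 1) - R ^ n\<close>; this choice of \<open>n\<close> lifts that difference above
    20.\<close>
  obtain n where "20 / (R - 1) < R ^ n" using real_arch_pow[OF R] by blast
  then have n: "20 < R ^ n * R - R ^ n" using R by (simp add: field_simps)
  define y where "y = x * r ^ n"
  have "star y * y = r ^ n * (1 - r * r) * r ^ n"
    using r by (simp add: y_def star_mult star_power mult.assoc)
  also have "\<dots> = r ^ n * r ^ n - r ^ n * r ^ n * (r * r)"
  proof -
    have "r * r * r ^ n = r ^ n * (r * r)" by (metis mult.assoc power_commutes)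
    then have "r ^ n * (r * r * r ^ n) = r ^ n * r ^ n * (r * r)" by (simp add: mult.assoc)
    moreover have "r ^ n * (1 - r * r) * r ^ n = r ^ n * r ^ n - r ^ n * (r * r * r ^ n)"
      by (simp add: left_diff_distrib right_diff_distrib mult.assoc)
    ultimately show ?thesis by (simp only:)
  qed
  also have "\<dots> = r ^ (2 * n) - r ^ (2 * n + 2)"
    by (simp only: mult_2 power_add power2_eq_square)
  finally have y: "star y * y = r ^ (2 * n) - r ^ (2 * n + 2)" .
  have "(norm y)\<^sup>2 < 20"
    using positive_one_minus_powers[OF r(1), of n] y
    by (intro norm_less_if_positive_one_minus_star_square) simp
  moreover have "norm (r ^ (2 * n + 2)) - norm (r ^ (2 * n)) \<le> (norm y)\<^sup>2"
    unfolding cstar_identity[symmetric] y by (metis norm_minus_commute norm_triangle_ineq2)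
  moreover have "norm (r ^ (2 * n + 2)) = R ^ n * R" "norm (r ^ (2 * n)) = R ^ n"
    unfolding norm_power_selfadjoint[OF r(1)] by (simp_all add: R_def power_add power_mult power2_eq_square)
  ultimately show False using n by simp
qed

text \<open>Rescaling to norm below 1 gives the witness 1 in the definition of positivity; dividing
  by \<open>norm x + 1\<close> covers \<open>x = 0\<close> too.\<close>

lemma positive_element_star_square: "positive_element (star x * (x::'a::cstar_algebra))"
proof -
  define s where "s = norm x + 1"
  have s: "s > 0" by (simp add: s_def add_nonneg_pos)
  define y where "y = (1 / s) *\<^sub>R x"
  have "norm (1 - star y * y) \<le> 1"
    using s by (intro norm_one_minus_star_square_le) (simp add: y_def s_def)
  then have "positive_element (star y * y)"
    by (auto simp: positive_element_def star_mult star_star intro!: exI[of _ 1])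
  from positive_element_scaleR[OF this, of "s * s"] show ?thesis
    using s by (simp add: y_def star_scaleR)
qed

section \<open>The Hahn-Banach theorem\<close>

text \<open>The inequality for \<open>c\<close> and for \<open>1 / c\<close> together give positive
  homogeneity; the one-sided form passes easily to infima.\<close>

definition sublinear :: "('a::real_vector \<Rightarrow> real) \<Rightarrow> bool" where
  "sublinear p \<longleftrightarrow> p 0 = 0 \<and> (\<forall>x y. p (x + y) \<le> p x + p y) \<and> (\<forall>c>0. \<forall>x. p (c *\<^sub>R x) \<le> c * p x)"

lemma sublinearD:
  assumes "sublinear p"
  shows "p 0 = 0" "p (x + y) \<le> p x + p y" "c > 0 \<Longrightarrow> p (c *\<^sub>R x) \<le> c * p x"
  using assms by (auto simp: sublinear_def)

text \<open>Every sublinear \<open>q\<close> below \<open>p\<close> is therefore at least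
  \<open>- p (- x)\<close> at \<open>x\<close>, which keeps infima of such functionals
  finite.\<close>

lemma sublinear_uminus_le: "sublinear p \<Longrightarrow> - p (- x) \<le> p x"
  using sublinearD(1)[of p] sublinearD(2)[of p x "- x"] by simp

text \<open>The infimum over \<open>t\<close> of \<open>p (y + t x) - t p x\<close> is the new
  functional; \<open>t = 0\<close> and \<open>t = 1\<close> give the two bounds. If \<open>p\<close>
  is minimal, then \<open>q = p\<close> and the last bound is superadditivity.\<close>

lemma sublinear_decrease:
  fixes p :: "'a::real_vector \<Rightarrow> real"
  assumes p: "sublinear p"
  obtains q where "sublinear q" "\<And>y. q y \<le> p y" "\<And>y. q y \<le> p (y + x) - p x"
proof -
  define q where "q y = (INF t\<in>{0..}. p (y + t *\<^sub>R x) - t * p x)" for y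
  have lower: "- p (- y) \<le> p (y + t *\<^sub>R x) - t * p x" if "t \<ge> 0" for y t
  proof -
    have "p (t *\<^sub>R x) \<le> p (y + t *\<^sub>R x) + p (- y)"
      using sublinearD(2)[OF p, of "y + t *\<^sub>R x" "- y"] by simp
    moreover have "t * p x \<le> p (t *\<^sub>R x)"
    proof (cases "t = 0")
      case False
      then have "p x \<le> (1 / t) * p (t *\<^sub>R x)"
        using sublinearD(3)[OF p, of "1 / t" "t *\<^sub>R x"] that by simp
      then show ?thesis using False that by (simp add: field_simps)
    qed (use sublinearD(1)[OF p] in simp)
    ultimately show ?thesis by simp
  qed
  then have "bdd_below ((\<lambda>t. p (y + t *\<^sub>R x) - t * p x) ` {0..})" for y by fastforce
  then have q_le: "q y \<le> p (y + t *\<^sub>R x) - t * p x" if "t \<ge> 0" for y t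
    unfolding q_def using that by (intro cINF_lower) auto
  have q_ge: "b \<le> q y" if "\<And>t. t \<ge> 0 \<Longrightarrow> b \<le> p (y + t *\<^sub>R x) - t * p x" for b y
    unfolding q_def using that by (intro cINF_greatest) auto
  have "sublinear q"
    unfolding sublinear_def
  proof (intro conjI allI impI)
    have "q 0 \<le> 0" using q_le[of 0 0] sublinearD(1)[OF p] by simp
    moreover have "0 \<le> q 0" using q_ge[of 0 0] lower[of _ 0] sublinearD(1)[OF p] by simp
    ultimately show "q 0 = 0" by simp
  next
    fix y z
    \<comment> \<open>Parameters \<open>s\<close> for \<open>y\<close> and \<open>t\<close> for
      \<open>z\<close> combine to \<open>s + t\<close> for \<open>y + z\<close>; the infima over
      \<open>t\<close> and \<open>s\<close> are taken one after the other.\<close>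
    have "q (y + z) - q z \<le> p (y + s *\<^sub>R x) - s * p x" if s: "s \<ge> 0" for s
    proof -
      have "q (y + z) - (p (y + s *\<^sub>R x) - s * p x) \<le> p (z + t *\<^sub>R x) - t * p x" if t: "t \<ge> 0" for t
      proof -
        have "p (y + z + (s + t) *\<^sub>R x) \<le> p (y + s *\<^sub>R x) + p (z + t *\<^sub>R x)"
          using sublinearD(2)[OF p, of "y + s *\<^sub>R x" "z + t *\<^sub>R x"] by (simp add: algebra_simps)
        then show ?thesis using q_le[of "s + t" "y + z"] s t by (simp add: algebra_simps)
      qed
      then show ?thesis using q_ge by force
    qed
    then show "q (y + z) \<le> q y + q z" using q_ge by force
  next
    fix c :: real and y assume c: "c > 0"
    have "q (c *\<^sub>R y) / c \<le> p (y + t *\<^sub>R x) - t * p x" if t: "t \<ge> 0" for t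
    proof -
      have "q (c *\<^sub>R y) \<le> p (c *\<^sub>R (y + t *\<^sub>R x)) - c * t * p x"
        using q_le[of "c * t" "c *\<^sub>R y"] c t by (simp add: scaleR_add_right)
      also have "\<dots> \<le> c * (p (y + t *\<^sub>R x) - t * p x)"
        using sublinearD(3)[OF p c, of "y + t *\<^sub>R x"] by (simp add: algebra_simps)
      finally show ?thesis using c by (simp add: field_simps)
    qed
    then show "q (c *\<^sub>R y) \<le> c * q y"
      using q_ge[of "q (c *\<^sub>R y) / c" y] c by (simp add: field_simps)
  qed
  moreover have "q y \<le> p y" for y using q_le[of 0 y] by simp
  moreover have "q y \<le> p (y + x) - p x" for y using q_le[of 1 y] by simp
  ultimately show thesis using that by blast
qed

text \<open>Subadditivity rests on the chain condition: of two members \<open>q\<close> and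
  \<open>r\<close> the smaller one, \<open>s\<close>, satisfies
  \<open>s (x + y) \<le> s x + s y \<le> q x + r y\<close>.\<close>

lemma sublinear_INF:
  fixes C :: "('a::real_vector \<Rightarrow> real) set"
  assumes C: "C \<noteq> {}" and sub: "\<And>q. q \<in> C \<Longrightarrow> sublinear q"
    and chain: "\<And>q r. q \<in> C \<Longrightarrow> r \<in> C \<Longrightarrow> q \<le> r \<or> r \<le> q"
    and bound: "\<And>q x. q \<in> C \<Longrightarrow> b x \<le> q x"
  shows "sublinear (\<lambda>x. INF q\<in>C. q x)"
proof -
  define u where "u x = (INF q\<in>C. q x)" for x
  have u_le: "u x \<le> q x" if "q \<in> C" for q x
    unfolding u_def using that bound by (intro cINF_lower bdd_belowI[of _ "b x"]) auto
  have u_ge: "c \<le> u x" if "\<And>q. q \<in> C \<Longrightarrow> c \<le> q x" for c x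
    unfolding u_def using C that by (intro cINF_greatest)
  have zero: "q 0 = 0" if "q \<in> C" for q using sublinearD(1)[OF sub[OF that]] .
  then have "0 \<le> u 0" by (intro u_ge) (simp add: zero)
  moreover obtain q where "q \<in> C" using C by blast
  then have "u 0 \<le> 0" using u_le[of q 0] zero[of q] by simp
  ultimately have "u 0 = 0" by simp
  moreover have "u (x + y) \<le> u x + u y" for x y
  proof -
    have le_add: "u (x + y) \<le> q x + r y" if "q \<in> C" "r \<in> C" for q r
    proof -
      have "\<exists>s\<in>C. s \<le> q \<and> s \<le> r"
      proof (cases "q \<le> r")
        case True
        then show ?thesis using that(1) by (intro bexI[of _ q] conjI order_refl)
      next
        case False
        then have "r \<le> q" using chain[OF that] by simp
        then show ?thesis using that(2) by (intro bexI[of _ r] conjI order_refl)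
      qed
      then obtain s where s: "s \<in> C" "s \<le> q" "s \<le> r" by (elim bexE conjE)
      have "u (x + y) \<le> s x + s y"
        using u_le[OF s(1)] sublinearD(2)[OF sub[OF s(1)]] by (rule order_trans)
      also have "\<dots> \<le> q x + r y" using le_funD[OF s(2)] le_funD[OF s(3)] by (rule add_mono)
      finally show ?thesis .
    qed
    have le: "u (x + y) - r y \<le> u x" if r: "r \<in> C" for r
    proof (rule u_ge)
      fix q assume "q \<in> C"
      from le_add[OF this r] show "u (x + y) - r y \<le> q x" by simp
    qed
    have "u (x + y) - u x \<le> u y"
    proof (rule u_ge)
      fix r assume "r \<in> C"
      from le[OF this] show "u (x + y) - u x \<le> r y" by simp
    qed
    then show ?thesis by simp
  qed
  moreover have "u (c *\<^sub>R x) \<le> c * u x" if c: "c > 0" for c x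
  proof -
    have "u (c *\<^sub>R x) / c \<le> q x" if "q \<in> C" for q
    proof -
      have "u (c *\<^sub>R x) \<le> c * q x"
        using u_le[OF that] sublinearD(3)[OF sub[OF that] c] by (rule order_trans)
      then show ?thesis using c by (simp add: field_simps)
    qed
    then show ?thesis using u_ge[of "u (c *\<^sub>R x) / c" x] c by (simp add: field_simps)
  qed
  ultimately have "sublinear u" by (simp add: sublinear_def)
  then show ?thesis by (simp add: u_def[abs_def])
qed

(* A minimal sublinear functional is linear. *)
lemma Hahn_Banach_sublinear:
  fixes p :: "'a::real_vector \<Rightarrow> real"
  assumes p: "sublinear p"
  obtains f where "linear f" "\<And>x. f x \<le> p x"
proof -
  define A where "A = {q. sublinear q \<and> q \<le> p}"
  \<comment> \<open>Zorn's lemma is applied to the reversed pointwise order, so a maximal element is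
    a minimal functional; the empty chain is bounded by \<open>p\<close>.\<close>
  have "\<exists>m\<in>A. \<forall>q\<in>A. q \<le> m \<longrightarrow> q = m"
  proof (rule predicate_Zorn)
    show "partial_order_on A (relation_of (\<lambda>q r. r \<le> q) A)"
      by (rule partial_order_on_relation_ofI) auto
  next
    fix C assume "C \<in> Chains (relation_of (\<lambda>q r. r \<le> q) A)"
    then have CA: "C \<subseteq> A" and chain: "\<And>q r. q \<in> C \<Longrightarrow> r \<in> C \<Longrightarrow> q \<le> r \<or> r \<le> q"
      by (auto simp: Chains_def relation_of_def)
    show "\<exists>u\<in>A. \<forall>q\<in>C. u \<le> q"
    proof (cases "C = {}")
      case True
      then show ?thesis using p by (auto simp: A_def)
    next
      case False
      have sub: "sublinear q" and le: "q x \<le> p x" if "q \<in> C" for q x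
        using CA that by (auto simp: A_def le_fun_def)
      have bound: "- p (- x) \<le> q x" if "q \<in> C" for q x
        using sublinear_uminus_le[OF sub[OF that], of x] le[OF that, of "- x"] by linarith
      define u where "u = (\<lambda>x. INF q\<in>C. q x)"
      have u_le: "u x \<le> q x" if "q \<in> C" for q x
        unfolding u_def using that bound by (intro cINF_lower bdd_belowI[of _ "- p (- x)"]) auto
      have "sublinear u"
        unfolding u_def using False sub chain bound by (rule sublinear_INF)
      moreover have "u \<le> p" using False u_le le by (fastforce simp: le_fun_def intro: order_trans)
      ultimately show ?thesis using u_le by (auto simp: A_def le_fun_def)
    qed
  qed
  then obtain m where "m \<in> A" and min: "\<And>q. q \<in> A \<Longrightarrow> q \<le> m \<Longrightarrow> q = m" by blast
  then have m: "sublinear m" "m \<le> p" by (auto simp: A_def)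
  have add: "m (x + y) = m x + m y" for x y
  proof -
    obtain q where q: "sublinear q" "\<And>y. q y \<le> m y" "\<And>y. q y \<le> m (y + x) - m x"
      by (rule sublinear_decrease[OF m(1), of x]) (rule that)
    then have "q \<le> m" by (simp add: le_fun_def)
    then have "q = m" using q(1) m(2) by (intro min) (auto simp: A_def)
    then show ?thesis
      using q(3)[of y] sublinearD(2)[OF m(1), of x y] by (simp add: add.commute)
  qed
  have minus: "m (- x) = - m x" for x
    using add[of x "- x"] sublinearD(1)[OF m(1)] by simp
  have pos: "m (c *\<^sub>R x) = c * m x" if "c > 0" for c x
  proof (rule antisym)
    have "m x \<le> (1 / c) * m (c *\<^sub>R x)"
      using sublinearD(3)[OF m(1), of "1 / c" "c *\<^sub>R x"] that by simp
    then show "c * m x \<le> m (c *\<^sub>R x)" using that by (simp add: field_simps)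
  qed (use sublinearD(3)[OF m(1) that] in simp)
  have "m (c *\<^sub>R x) = c *\<^sub>R m x" for c x
    using pos[of c x] pos[of "- c" x] minus[of "c *\<^sub>R x"] sublinearD(1)[OF m(1)]
    by (cases c "0 :: real" rule: linorder_cases) auto
  then have "linear m" using add by (intro linearI)
  then show thesis using m(2) that by (auto simp: le_fun_def)
qed

section \<open>Existence of states\<close>

lemma real_part_add: "real_part (x + y) = real_part x + real_part (y::'a::cstar_algebra)"
  by (simp add: real_part_def star_add scaleR_add_right)

lemma real_part_scaleR: "real_part (r *\<^sub>R x) = r *\<^sub>R real_part (x::'a::cstar_algebra)"
  by (simp add: real_part_def star_scaleR scaleR_add_right)

lemma imag_part_add: "imag_part (x + y) = imag_part x + imag_part (y::'a::cstar_algebra)"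
  by (simp add: imag_part_def real_part_add scaleC_add_right)

lemma imag_part_scaleR: "imag_part (r *\<^sub>R x) = r *\<^sub>R imag_part (x::'a::cstar_algebra)"
  by (simp add: imag_part_def real_part_scaleR scaleC_scaleR)

lemma real_part_ii: "real_part (\<i> *\<^sub>C x) = - imag_part (x::'a::cstar_algebra)"
  using real_part_scaleR[of "-1" "\<i> *\<^sub>C x"] by (simp add: imag_part_def scaleC_minus_left)

lemma imag_part_ii: "imag_part (\<i> *\<^sub>C x) = real_part (x::'a::cstar_algebra)"
  by (simp add: imag_part_def scaleC_scaleC scaleC_one)

lemma real_part_selfadjoint: "star x = x \<Longrightarrow> real_part x = (x::'a::cstar_algebra)"
  by (simp add: real_part_def flip: scaleR_2)

lemma imag_part_selfadjoint:
  fixes x :: "'a::cstar_algebra"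
  assumes "star x = x"
  shows "imag_part x = 0"
  using assms scaleC_scaleR[of \<i> 0 0] by (simp add: imag_part_eq)

lemma scaleC_conv_scaleR: "c *\<^sub>C x = Re c *\<^sub>R x + Im c *\<^sub>R \<i> *\<^sub>C (x::'a::cstar_algebra)"
proof -
  have "c = of_real (Re c) + of_real (Im c) * \<i>" by (simp add: complex_eq_iff)
  then have "c *\<^sub>C x = (of_real (Re c) + of_real (Im c) * \<i>) *\<^sub>C x" by (rule arg_cong)
  then show ?thesis
    by (simp add: scaleC_add_left scaleC_of_real flip: scaleC_scaleC)
qed

text \<open>Decreasing the norm in the direction 1 first gives \<open>q (- 1) \<le> - 1\<close>, so
  any linear functional below \<open>q\<close> has value 1 at 1. This replaces an extension from the
  line spanned by 1.\<close>

lemma exists_norming_functional: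
  obtains f :: "'a::real_normed_algebra_1 \<Rightarrow> real"
  where "linear f" "\<And>x. f x \<le> norm x" "f 1 = 1"
proof -
  have "sublinear (norm :: 'a \<Rightarrow> real)"
    by (simp add: sublinear_def norm_triangle_ineq)
  obtain q :: "'a \<Rightarrow> real"
    where q: "sublinear q" "\<And>y. q y \<le> norm y" "\<And>y. q y \<le> norm (y + 1) - norm (1::'a)"
    by (rule sublinear_decrease[OF \<open>sublinear norm\<close>, of 1]) (rule that)
  obtain f where f: "linear f" "\<And>x. f x \<le> q x"
    by (rule Hahn_Banach_sublinear[OF q(1)]) (rule that)
  have "f (- 1) \<le> - 1" using f(2)[of "- 1"] q(3)[of "- 1"] by simp
  moreover have "f 1 \<le> 1" using f(2)[of 1] q(2)[of 1] by simp
  ultimately have "f 1 = 1" using linear_neg[OF f(1), of 1] by simp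
  then show thesis using that f(1) order_trans[OF f(2) q(2)] by simp
qed

text \<open>A norming real functional is evaluated on real and imaginary parts to make it complex
  linear. Domination by the norm and value 1 at 1 make it positive, since \<open>star x * x\<close>
  is a positive element.\<close>

lemma states_nonempty: "(states :: ('a::cstar_algebra \<Rightarrow> complex) set) \<noteq> {}"
proof -
  obtain f :: "'a \<Rightarrow> real" where f: "linear f" "\<And>x. f x \<le> norm x" "f 1 = 1"
    by (rule exists_norming_functional) (rule that)
  define \<phi> where "\<phi> x = Complex (f (real_part x)) (f (imag_part x))" for x
  have add: "\<phi> (x + y) = \<phi> x + \<phi> y" for x y
    by (simp add: \<phi>_def real_part_add imag_part_add linear_add[OF f(1)] complex_eq_iff)
  have scaleR: "\<phi> (r *\<^sub>R x) = of_real r * \<phi> x" for r x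
    by (simp add: \<phi>_def real_part_scaleR imag_part_scaleR linear_scale[OF f(1)] complex_eq_iff)
  have ii: "\<phi> (\<i> *\<^sub>C x) = \<i> * \<phi> x" for x
    by (simp add: \<phi>_def real_part_ii imag_part_ii linear_neg[OF f(1)] complex_eq_iff)
  have "\<phi> (c *\<^sub>C x) = c * \<phi> x" for c x
  proof -
    have "\<phi> (c *\<^sub>C x) = (of_real (Re c) + \<i> * of_real (Im c)) * \<phi> x"
      unfolding scaleC_conv_scaleR[of c x] add scaleR ii by (simp add: algebra_simps)
    moreover have "of_real (Re c) + \<i> * of_real (Im c) = c" by (simp add: complex_eq_iff)
    ultimately show ?thesis by (simp only:)
  qed
  with add have "clinear_functional \<phi>" by (simp add: clinear_functional_def)
  moreover have sa: "\<phi> h = of_real (f h)" if "star h = h" for h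
    using that by (simp add: \<phi>_def real_part_selfadjoint imag_part_selfadjoint linear_0[OF f(1)]
        complex_eq_iff)
  have "f (star x * x) \<ge> 0" for x
  proof -
    obtain t where t: "norm (of_real t - star x * x) \<le> t"
      using positive_element_star_square[of x] by (auto simp: positive_element_def)
    have "t - f (star x * x) = f (of_real t - star x * x)"
      using f(3) linear_scale[OF f(1), of t 1] by (simp add: linear_diff[OF f(1)] of_real_def)
    also have "\<dots> \<le> t" using f(2) t by (rule order_trans)
    finally show ?thesis by simp
  qed
  then have "positive_functional \<phi>"
    by (simp add: positive_functional_def sa star_mult star_star)
  moreover have "\<phi> 1 = 1" using f(3) by (simp add: sa star_one)
  ultimately show ?thesis by (auto simp: states_def)
qed

section \<open>Inequalities for states\<close>

context
  fixes \<phi> :: "'a::cstar_algebra \<Rightarrow> complex"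
  assumes state: "\<phi> \<in> states"
begin

lemma state_add: "\<phi> (x + y) = \<phi> x + \<phi> y"
  and state_scaleC: "\<phi> (c *\<^sub>C x) = c * \<phi> x"
  and state_one: "\<phi> 1 = 1"
  and state_star_square: "\<phi> (star x * x) \<in> \<real>\<^sub>\<ge>\<^sub>0"
  using state by (auto simp: states_def clinear_functional_def positive_functional_def)

lemma state_scaleR: "\<phi> (r *\<^sub>R x) = of_real r * \<phi> x"
  by (metis scaleC_of_real state_scaleC)

lemma state_diff: "\<phi> (x - y) = \<phi> x - \<phi> y"
  using state_add[of "x - y" y] by simp

text \<open>For \<open>s > norm h\<close> the element \<open>1 - h / s\<close> is the square of a
  selfadjoint one, so a state is real and nonnegative on it; then \<open>s\<close> tends to
  \<open>norm h\<close>.\<close>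

lemma state_selfadjoint:
  assumes h: "star h = h"
  shows "Im (\<phi> h) = 0" "Re (\<phi> h) \<le> norm h"
proof -
  have *: "Im (\<phi> h) = 0 \<and> Re (\<phi> h) \<le> norm h + e" if e: "e > 0" for e
  proof -
    define s where "s = norm h + e"
    have s: "s > 0" "norm h < s" using e by (auto simp: s_def add_nonneg_pos)
    obtain y where y: "star y = y" "y * y = 1 - (1 / s) *\<^sub>R h"
      using selfadjoint_sqrt[of "(1 / s) *\<^sub>R h"] s h by (auto simp: star_scaleR)
    have "\<phi> (1 - (1 / s) *\<^sub>R h) \<in> \<real>\<^sub>\<ge>\<^sub>0" using state_star_square[of y] y by simp
    then have "1 - of_real (1 / s) * \<phi> h \<in> \<real>\<^sub>\<ge>\<^sub>0"
      by (simp only: state_diff state_scaleR state_one)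
    then have "Im (\<phi> h) = 0 \<and> Re (\<phi> h) \<le> s"
      using s by (simp add: complex_nonneg_Reals_iff field_simps)
    then show ?thesis by (simp add: s_def)
  qed
  show "Im (\<phi> h) = 0" using *[of 1] by simp
  show "Re (\<phi> h) \<le> norm h"
    by (rule field_le_epsilon) (simp add: *)
qed

lemma state_star: "\<phi> (star x) = cnj (\<phi> x)"
proof -
  have "star x = real_part x - \<i> *\<^sub>C imag_part x"
    using arg_cong[OF real_imag_parts[of x], of star]
    by (simp add: star_add star_scaleC star_real_part star_imag_part scaleC_minus_left)
  moreover have "\<phi> x = \<phi> (real_part x) + \<i> * \<phi> (imag_part x)"
    using arg_cong[OF real_imag_parts[of x], of \<phi>] by (simp add: state_add state_scaleC)
  ultimately show ?thesis
    using state_selfadjoint(1)[OF star_real_part[of x]] state_selfadjoint(1)[OF star_imag_part[of x]]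
    by (simp add: state_diff state_scaleC complex_eq_iff)
qed

text \<open>Positivity at \<open>a - z b\<close>, where \<open>z\<close> is a real multiple
  \<open>s\<close> of \<open>\<phi> (star b * a)\<close>, gives a nonnegative real quadratic in
  \<open>s\<close>.\<close>

lemma state_Cauchy_Schwarz:
  "(cmod (\<phi> (star b * a)))\<^sup>2 \<le> Re (\<phi> (star a * a)) * Re (\<phi> (star b * b))"
proof -
  define c \<alpha> \<beta> where "c = \<phi> (star b * a)" and "\<alpha> = Re (\<phi> (star a * a))" and "\<beta> = Re (\<phi> (star b * b))"
  have \<beta>: "\<beta> \<ge> 0" using state_star_square[of b] by (simp add: \<beta>_def complex_nonneg_Reals_iff)
  have c': "\<phi> (star a * b) = cnj c" using state_star[of "star b * a"] by (simp add: c_def star_mult star_star)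
  have ineq: "0 \<le> \<alpha> - 2 * s * (cmod c)\<^sup>2 + s\<^sup>2 * (cmod c)\<^sup>2 * \<beta>" for s
  proof -
    define z where "z = of_real s * c"
    have "star (a - z *\<^sub>C b) * (a - z *\<^sub>C b) =
      star a * a - z *\<^sub>C (star a * b) - cnj z *\<^sub>C (star b * a) + (cnj z * z) *\<^sub>C (star b * b)"
      by (simp add: star_diff star_scaleC left_diff_distrib right_diff_distrib mult_scaleC_left
          mult_scaleC_right scaleC_diff_right scaleC_scaleC mult.commute)
    then have "\<phi> (star (a - z *\<^sub>C b) * (a - z *\<^sub>C b)) =
      \<phi> (star a * a) - z * cnj c - cnj z * c + cnj z * z * \<phi> (star b * b)"
      by (simp only: state_add state_diff state_scaleC c' c_def[symmetric])
    also have "Re \<dots> = \<alpha> - 2 * s * (cmod c)\<^sup>2 + s\<^sup>2 * (cmod c)\<^sup>2 * \<beta>"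
    proof -
      have cc: "c * cnj c = of_real ((cmod c)\<^sup>2)" by (rule complex_norm_square[symmetric])
      have "z * cnj c = of_real (s * (cmod c)\<^sup>2)"
        by (simp only: z_def mult.assoc of_real_mult cc)
      moreover have "cnj z * c = of_real (s * (cmod c)\<^sup>2)"
        by (simp add: z_def mult.assoc cc mult.commute[of "cnj c"])
      moreover have "cnj z * z = of_real (s * s) * (c * cnj c)"
        by (simp add: z_def mult_ac)
      then have "cnj z * z = of_real (s\<^sup>2 * (cmod c)\<^sup>2)"
        by (simp only: cc of_real_mult power2_eq_square)
      ultimately show ?thesis
        by (simp only: minus_complex.sel plus_complex.sel Re_complex_of_real)
          (simp add: \<alpha>_def \<beta>_def algebra_simps)
    qed
    finally show ?thesis
      using state_star_square[of "a - z *\<^sub>C b"] by (simp add: complex_nonneg_Reals_iff)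
  qed
  have "(cmod c)\<^sup>2 \<le> \<alpha> * \<beta>"
  proof (cases "\<beta> = 0")
    case True
    have "c = 0"
    proof (rule ccontr)
      assume "c \<noteq> 0"
      \<comment> \<open>The chosen \<open>s\<close> makes the expression equal to -1.\<close>
      then show False
        using ineq[of "(\<alpha> + 1) / (2 * (cmod c)\<^sup>2)"] True by simp
    qed
    then show ?thesis using True by simp
  next
    case False
    \<comment> \<open>The value \<open>s = 1 / \<beta>\<close> minimizes the quadratic.\<close>
    then have "0 \<le> \<alpha> - (cmod c)\<^sup>2 / \<beta>"
      using ineq[of "1 / \<beta>"] by (simp add: power2_eq_square)
    then show ?thesis using False \<beta> by (simp add: field_simps)
  qed
  then show ?thesis by (simp add: c_def \<alpha>_def \<beta>_def)
qed

text \<open>Cauchy-Schwarz against 1. This bounds the set whose supremum is the numerical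
  radius.\<close>

lemma state_cmod_le_norm: "cmod (\<phi> x) \<le> norm x"
proof -
  have "(cmod (\<phi> x))\<^sup>2 \<le> Re (\<phi> (star x * x))"
    using state_Cauchy_Schwarz[of 1 x] by (simp add: star_one state_one)
  also have "\<dots> \<le> (norm x)\<^sup>2"
    using state_selfadjoint(2)[of "star x * x"] by (simp add: star_mult star_star cstar_identity)
  finally show ?thesis by (rule power2_le_imp_le) simp
qed

end

section \<open>Moore-Penrose inverses and bounds for a single element\<close>

lemma Moore_Penrose_projection:
  assumes "is_moore_penrose_inverse x y"
  shows "star (x * y) = x * y" "x * y * x = x" "x * y * (x * y) = x * y"
proof -
  show "star (x * y) = x * y" "x * y * x = x"
    using assms unfolding is_moore_penrose_inverse_def by metis+
  then show "x * y * (x * y) = x * y" by (metis mult.assoc)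
qed

lemma state_cmod_le_numerical_radius:
  fixes x :: "'a::cstar_algebra"
  assumes "\<phi> \<in> states"
  shows "cmod (\<phi> x) \<le> numerical_radius x"
  unfolding numerical_radius_def
  using assms state_cmod_le_norm by (intro cSUP_upper bdd_aboveI[of _ "norm x"]) auto

lemma numerical_radius_nonneg: "0 \<le> numerical_radius (x :: 'a::cstar_algebra)"
proof -
  obtain \<phi> :: "'a \<Rightarrow> complex" where "\<phi> \<in> states" using states_nonempty by blast
  from state_cmod_le_numerical_radius[OF this, of x] show ?thesis
    by (rule order_trans[OF norm_ge_zero])
qed

context
  fixes \<phi> :: "'a::cstar_algebra \<Rightarrow> complex"
  assumes state: "\<phi> \<in> states"
begin

(* Cauchy-Schwarz for x = (x y) x, where x y is a projection. *)
lemma state_Moore_Penrose_bound: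
  assumes "is_moore_penrose_inverse x y"
  shows "(cmod (\<phi> x))\<^sup>2 \<le> Re (\<phi> (x * y)) * Re (\<phi> (star x * x))"
  using state_Cauchy_Schwarz[OF state, of "x * y" x]
  by (simp only: Moore_Penrose_projection[OF assms] mult.commute)

lemma state_selfadjoint_square_le:
  assumes "star h = h"
  shows "(Re (\<phi> h))\<^sup>2 \<le> Re (\<phi> (h * h))"
  using state_Cauchy_Schwarz[OF state, of 1 h] state_selfadjoint(1)[OF state assms] assms
  by (simp add: star_one state_one[OF state] cmod_power2)

text \<open>The root is taken after the mean inequality, so that one factor
  \<open>cmod (\<phi> x)\<close> is bounded by the norm and the other by the numerical
  radius.\<close>

lemma state_cmod_square_le_numerical_radius:
  assumes mp: "is_moore_penrose_inverse x y"
  shows "(cmod (\<phi> x))\<^sup>2 \<le> numerical_radius x * norm (x * y + star x * x) / 2"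
proof -
  define p k where "p = Re (\<phi> (x * y))" and "k = Re (\<phi> (star x * x))"
  note sa = Moore_Penrose_projection[OF mp]
  \<comment> \<open>The projection \<open>x * y\<close> equals its own star square, so
    \<open>p\<close> is nonnegative as well.\<close>
  have pos: "p \<ge> 0" "k \<ge> 0"
    using state_star_square[OF state, of "x * y"] state_star_square[OF state, of x]
    by (auto simp: p_def k_def complex_nonneg_Reals_iff sa)
  have pk: "p + k \<le> norm (x * y + star x * x)"
    using state_selfadjoint(2)[OF state, of "x * y + star x * x"]
    by (simp add: p_def k_def state_add[OF state] star_add star_mult[of "star x"] star_star sa)
  have "(cmod (\<phi> x))\<^sup>2 \<le> p * k"
    using state_Moore_Penrose_bound[OF mp] by (simp add: p_def k_def)
  also have "\<dots> \<le> ((p + k) / 2)\<^sup>2"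
    using sum_squares_bound[of p k] by (simp add: power_divide power2_sum mult_ac)
  finally have "cmod (\<phi> x) \<le> (p + k) / 2"
    by (rule power2_le_imp_le) (use pos in simp)
  also have "\<dots> \<le> norm (x * y + star x * x) / 2" using pk by (rule divide_right_mono) simp
  finally have "cmod (\<phi> x) * cmod (\<phi> x) \<le> numerical_radius x * (norm (x * y + star x * x) / 2)"
    by (intro mult_mono state_cmod_le_numerical_radius[OF state, of x] numerical_radius_nonneg) auto
  then show ?thesis by (simp add: power2_eq_square)
qed

text \<open>The squares from the mean inequality move inside \<phi> by
  \<open>state_selfadjoint_square_le\<close>; the projection is unchanged by squaring.\<close>

lemma state_cmod_square_le_square:
  assumes mp: "is_moore_penrose_inverse x y"
  shows "(cmod (\<phi> x))\<^sup>2 \<le> Re (\<phi> (x * y + (star x * x)\<^sup>2)) / 2"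
proof -
  define p k where "p = Re (\<phi> (x * y))" and "k = Re (\<phi> (star x * x))"
  note xy = Moore_Penrose_projection[OF mp]
  have xx: "star (star x * x) = star x * x" by (simp add: star_mult star_star)
  have "(cmod (\<phi> x))\<^sup>2 \<le> p * k"
    using state_Moore_Penrose_bound[OF mp] by (simp add: p_def k_def)
  also have "\<dots> \<le> (p\<^sup>2 + k\<^sup>2) / 2"
    using sum_squares_bound[of p k] by simp
  also have "\<dots> \<le> Re (\<phi> (x * y + (star x * x)\<^sup>2)) / 2"
    using state_selfadjoint_square_le[OF xy(1)] state_selfadjoint_square_le[OF xx]
    by (simp add: p_def k_def state_add[OF state] xy(3) power2_eq_square[of "star x * x"])
  finally show ?thesis .
qed

end

section \<open>The numerical radius inequality\<close>

text \<open>The weights are \<open>1 / (1 + \<mu>)\<close> and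
  \<open>\<mu> / (1 + \<mu>)\<close>.\<close>

lemma le_weighted_average:
  fixes s a b \<mu> :: real
  assumes "s \<le> a / 2" "s \<le> b / 2" "\<mu> \<ge> 0"
  shows "s \<le> 1 / (2 * (1 + \<mu>)) * a + \<mu> / (2 * (1 + \<mu>)) * b"
proof -
  have "s + \<mu> * s \<le> a / 2 + \<mu> * (b / 2)"
    using assms by (intro add_mono mult_left_mono)
  then have "s \<le> (a / 2 + \<mu> * (b / 2)) / (1 + \<mu>)"
    using assms(3) by (simp add: pos_le_divide_eq algebra_simps)
  also have "\<dots> = 1 / (2 * (1 + \<mu>)) * a + \<mu> / (2 * (1 + \<mu>)) * b"
    using assms(3) by (simp add: divide_simps)
  finally show ?thesis .
qed

theorem theorem4p3:
  fixes x1 x2 x1_dag x2_dag :: "'a::cstar_algebra" and \<mu> :: real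
  assumes "regular_element x1" and "regular_element x2"
    and "is_moore_penrose_inverse x1 x1_dag" and "is_moore_penrose_inverse x2 x2_dag"
    and "\<mu> \<ge> 0"
  shows "(numerical_radius (x1 + x2))\<^sup>2 \<le>
      1 / (2 * (1 + \<mu>)) *
        (numerical_radius x1 * norm (x1 * x1_dag + star x1 * x1)
         + numerical_radius x2 * norm (x2 * x2_dag + star x2 * x2))
      + \<mu> / (2 * (1 + \<mu>)) *
        norm (x1 * x1_dag + x2 * x2_dag + (star x1 * x1)\<^sup>2 + (star x2 * x2)\<^sup>2)
      + 2 * numerical_radius x1 * numerical_radius x2"
    (is "_ \<le> 1 / _ * ?A + \<mu> / _ * norm ?h + ?B")
proof -
  let ?rhs = "1 / (2 * (1 + \<mu>)) * ?A + \<mu> / (2 * (1 + \<mu>)) * norm ?h + ?B"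
  have bound: "(cmod (\<phi> (x1 + x2)))\<^sup>2 \<le> ?rhs" if \<phi>: "\<phi> \<in> states" for \<phi> :: "'a \<Rightarrow> complex"
  proof -
    define a b where "a = cmod (\<phi> x1)" and "b = cmod (\<phi> x2)"
    have "cmod (\<phi> (x1 + x2)) \<le> a + b"
      unfolding a_def b_def state_add[OF \<phi>] by (rule norm_triangle_ineq)
    then have "(cmod (\<phi> (x1 + x2)))\<^sup>2 \<le> (a + b)\<^sup>2" by (rule power_mono) simp
    also have "\<dots> = (a\<^sup>2 + b\<^sup>2) + 2 * (a * b)" by (simp add: power2_sum)
    finally have sum: "(cmod (\<phi> (x1 + x2)))\<^sup>2 \<le> (a\<^sup>2 + b\<^sup>2) + 2 * (a * b)" .
    have ab: "a * b \<le> numerical_radius x1 * numerical_radius x2"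
      unfolding a_def b_def
      by (intro mult_mono state_cmod_le_numerical_radius[OF \<phi>] numerical_radius_nonneg) auto
    have A: "a\<^sup>2 + b\<^sup>2 \<le> ?A / 2"
      using state_cmod_square_le_numerical_radius[OF \<phi> assms(3)]
        state_cmod_square_le_numerical_radius[OF \<phi> assms(4)]
      by (simp add: a_def b_def)
    \<comment> \<open>The values of \<phi> are added before passing to the norm, which gives one
      norm of the whole sum instead of a sum of two norms.\<close>
    have H: "a\<^sup>2 + b\<^sup>2 \<le> norm ?h / 2"
    proof -
      have "star ?h = ?h"
        using Moore_Penrose_projection(1)[OF assms(3)] Moore_Penrose_projection(1)[OF assms(4)]
        by (simp add: star_add star_power star_mult[of "star _"] star_star)
      then have "Re (\<phi> ?h) \<le> norm ?h" by (rule state_selfadjoint(2)[OF \<phi>])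
      then show ?thesis
        using state_cmod_square_le_square[OF \<phi> assms(3)] state_cmod_square_le_square[OF \<phi> assms(4)]
        by (simp add: a_def b_def state_add[OF \<phi>])
    qed
    have "a\<^sup>2 + b\<^sup>2 \<le> 1 / (2 * (1 + \<mu>)) * ?A + \<mu> / (2 * (1 + \<mu>)) * norm ?h"
      by (rule le_weighted_average[OF A H assms(5)])
    with ab sum show ?thesis by linarith
  qed
  obtain \<phi>0 :: "'a \<Rightarrow> complex" where \<phi>0: "\<phi>0 \<in> states" using states_nonempty by blast
  \<comment> \<open>The supremum is over moduli and not their squares, so the bound passes to it in
    square-root form.\<close>
  have le: "numerical_radius (x1 + x2) \<le> sqrt ?rhs"
    unfolding numerical_radius_def[of "x1 + x2"]
    by (rule cSUP_least[OF states_nonempty real_le_rsqrt[OF bound]])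
  have "0 \<le> ?rhs" using bound[OF \<phi>0] by (rule order_trans[OF zero_le_power2])
  have "(numerical_radius (x1 + x2))\<^sup>2 \<le> (sqrt ?rhs)\<^sup>2"
    using le numerical_radius_nonneg by (rule power_mono)
  also have "\<dots> = ?rhs" using \<open>0 \<le> ?rhs\<close> by (rule real_sqrt_pow2)
  finally show ?thesis .
qed

end
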